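(* Consider a secretary problem with advice (setting in the context) whose signaling structure satisfies Non-Filtering and History-Irrelevance. Then the optimal policy is a memoryless policy: there is a memoryless policy whose probability of stopping at a secretary $i$ with $r_i=n$ is at least that of every (possibly randomized) policy.
   Context: Setting (secretaries with advice). Fix $n\ge 1$ and a signal space $\mathcal S$. A random vector $(r_1,\dots,r_n,s_1,\dots,s_n)$ has a known joint distribution, where $r_i\in\{1,\dots,n\}$ is the rank of the $i$-th arriving secretary (higher is better; $r_i=n$ for at least one $i$; in the case without ties $(r_1,\dots,r_n)$ is a permutation of $\{1,\dots,n\}$) and $s_i\in\mathcal S$ is its signal. Write $i\succeq j$ if $r_i\ge r_j$, and let $\preceq_{1..i}$ denote the relative order (all comparisons) among secretaries $1,\dots,i$. At time $i$ the algorithm observes $(\preceq_{1..i},s_1,\dots,s_i)$ (but not the ranks) and decides, possibly using randomization, whether to stop and select secretary $i$ irrevocably; a policy maps this information to a stopping probability. The policy wins if it stops at some $i$ with $r_i=n$. The best-so-far event is $T_i=\{i\succeq j \text{ for all } j<i\}$. Non-Filtering (NF): for all $j<i$, the conditional distribution of $(\preceq_{1..j},s_1,\dots,s_j)$ given $(T_j,s_j)$ equals its conditional distribution given $(T_j,s_j,T_i,s_i)$. History-Irrelevance (HI): conditioned on $(T_i,s_i)$, the random variable $(\preceq_{1..i},s_1,\dots,s_i)$ and the event $\{r_i=n\}$ are independent. A memoryless policy is one whose stopping probability at round $i$ depends only on $i$, on whether $T_i$ occurs, and on $s_i$. *)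

theory Defs
  imports "HOL-Probability.Probability"
begin

text \<open>
  Secretaries are indexed by arrival time \<open>1, \<dots>, n\<close>. The random vector lives on a probability
  space \<open>M\<close>; \<open>r i\<close> is the rank and \<open>s i\<close> the signal of the \<open>i\<close>-th arrival. The signal space is an
  arbitrary measurable space \<open>S\<close>. Ties are allowed; the case without ties is the special case in
  which \<open>r\<close> is a permutation of \<open>{1..n}\<close>.
\<close>

locale secretary_advice = prob_space M
  for n :: nat and M :: "'w measure" and r :: "nat \<Rightarrow> 'w \<Rightarrow> nat"
    and S :: "'s measure" and s :: "nat \<Rightarrow> 'w \<Rightarrow> 's" +
  assumes n_ge_1: "1 \<le> n"
    and rank_measurable: "\<And>i. i \<in> {1..n} \<Longrightarrow> r i \<in> measurable M (count_space UNIV)"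
    and signal_measurable: "\<And>i. i \<in> {1..n} \<Longrightarrow> s i \<in> measurable M S"
    and rank_range: "\<And>i \<omega>. i \<in> {1..n} \<Longrightarrow> \<omega> \<in> space M \<Longrightarrow> r i \<omega> \<in> {1..n}"
    and top_rank_exists: "\<And>\<omega>. \<omega> \<in> space M \<Longrightarrow> \<exists>i\<in>{1..n}. r i \<omega> = n"

text \<open>The pair \<open>(j, k)\<close> belongs to the relative order iff \<open>j\<close> is weakly worse than \<open>k\<close>.\<close>

definition rel_order :: "(nat \<Rightarrow> 'w \<Rightarrow> nat) \<Rightarrow> nat \<Rightarrow> 'w \<Rightarrow> (nat \<times> nat) set" where
  "rel_order r i \<omega> = {(j, k). j \<in> {1..i} \<and> k \<in> {1..i} \<and> r j \<omega> \<le> r k \<omega>}"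

definition info ::
    "(nat \<Rightarrow> 'w \<Rightarrow> nat) \<Rightarrow> (nat \<Rightarrow> 'w \<Rightarrow> 's) \<Rightarrow> nat \<Rightarrow> 'w \<Rightarrow> (nat \<times> nat) set \<times> (nat \<Rightarrow> 's)" where
  "info r s i \<omega> = (rel_order r i \<omega>, \<lambda>j\<in>{1..i}. s j \<omega>)"

definition info_space :: "'s measure \<Rightarrow> nat \<Rightarrow> ((nat \<times> nat) set \<times> (nat \<Rightarrow> 's)) measure" where
  "info_space S i = count_space (Pow ({1..i} \<times> {1..i})) \<Otimes>\<^sub>M (\<Pi>\<^sub>M j\<in>{1..i}. S)"

definition best_so_far :: "'w measure \<Rightarrow> (nat \<Rightarrow> 'w \<Rightarrow> nat) \<Rightarrow> nat \<Rightarrow> 'w set" where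
  "best_so_far M r i = {\<omega> \<in> space M. \<forall>j\<in>{1..<i}. r j \<omega> \<le> r i \<omega>}"

text \<open>
  \<open>cond_pr M E Y N A\<close> is (a version of) the conditional probability of \<open>A\<close> given that the event
  \<open>E\<close> occurs and given the value of the \<open>N\<close>-valued random variable \<open>Y\<close>: the conditional
  expectation of the indicator of \<open>A\<close> given \<open>\<sigma>(Y)\<close> under the law \<open>P(\<cdot> | E)\<close>. It is determined up to
  null sets of \<open>uniform_measure M E\<close>; if \<open>E\<close> has probability \<open>0\<close> this is the zero measure, and
  statements holding almost everywhere with respect to it are vacuous.
\<close>

definition cond_pr ::
    "'w measure \<Rightarrow> 'w set \<Rightarrow> ('w \<Rightarrow> 'y) \<Rightarrow> 'y measure \<Rightarrow> 'w set \<Rightarrow> 'w \<Rightarrow> real" where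
  "cond_pr M E Y N A =
     real_cond_exp (uniform_measure M E) (vimage_algebra (space M) Y N) (indicator A)"

text \<open>
  Since \<open>S\<close> need not be standard Borel, equality of conditional distributions is expressed by
  almost sure equality of the conditional probabilities of every measurable set of histories.
\<close>

definition non_filtering ::
    "nat \<Rightarrow> 'w measure \<Rightarrow> (nat \<Rightarrow> 'w \<Rightarrow> nat) \<Rightarrow> 's measure \<Rightarrow> (nat \<Rightarrow> 'w \<Rightarrow> 's) \<Rightarrow> bool" where
  "non_filtering n M r S s \<longleftrightarrow>
     (\<forall>i\<in>{1..n}. \<forall>j\<in>{1..<i}. \<forall>B\<in>sets (info_space S j).
        let A = {\<omega> \<in> space M. info r s j \<omega> \<in> B};
            Tj = best_so_far M r j;
            Ti = best_so_far M r i
        in AE \<omega> in uniform_measure M (Tj \<inter> Ti).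
             cond_pr M Tj (s j) S A \<omega>
             = cond_pr M (Tj \<inter> Ti) (\<lambda>\<omega>. (s j \<omega>, s i \<omega>)) (S \<Otimes>\<^sub>M S) A \<omega>)"

definition history_irrelevance ::
    "nat \<Rightarrow> 'w measure \<Rightarrow> (nat \<Rightarrow> 'w \<Rightarrow> nat) \<Rightarrow> 's measure \<Rightarrow> (nat \<Rightarrow> 'w \<Rightarrow> 's) \<Rightarrow> bool" where
  "history_irrelevance n M r S s \<longleftrightarrow>
     (\<forall>i\<in>{1..n}. \<forall>B\<in>sets (info_space S i).
        let A = {\<omega> \<in> space M. info r s i \<omega> \<in> B};
            W = {\<omega> \<in> space M. r i \<omega> = n};
            Ti = best_so_far M r i
        in AE \<omega> in uniform_measure M Ti.
             cond_pr M Ti (s i) S (A \<inter> W) \<omega>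
             = cond_pr M Ti (s i) S A \<omega> * cond_pr M Ti (s i) S W \<omega>)"

text \<open>
  A (randomized) policy assigns to the information available at round \<open>i\<close> the probability of
  stopping at \<open>i\<close>, conditionally on not having stopped before.
\<close>

definition policy ::
    "nat \<Rightarrow> 's measure \<Rightarrow> (nat \<Rightarrow> (nat \<times> nat) set \<times> (nat \<Rightarrow> 's) \<Rightarrow> real) \<Rightarrow> bool" where
  "policy n S \<pi> \<longleftrightarrow>
     (\<forall>i\<in>{1..n}. \<pi> i \<in> borel_measurable (info_space S i) \<and>
                (\<forall>x\<in>space (info_space S i). 0 \<le> \<pi> i x \<and> \<pi> i x \<le> 1))"

text \<open>
  The occurrence of \<open>best_so_far M r i\<close> is read off the relative order. Measurability of \<open>q\<close> in the
  signal is inherited from that of \<open>\<pi>\<close> when \<open>\<pi>\<close> is a policy.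
\<close>

definition memoryless ::
    "nat \<Rightarrow> 's measure \<Rightarrow> (nat \<Rightarrow> (nat \<times> nat) set \<times> (nat \<Rightarrow> 's) \<Rightarrow> real) \<Rightarrow> bool" where
  "memoryless n S \<pi> \<longleftrightarrow>
     (\<exists>q :: nat \<Rightarrow> bool \<Rightarrow> 's \<Rightarrow> real.
        \<forall>i\<in>{1..n}. \<forall>(R, \<sigma>)\<in>space (info_space S i).
          \<pi> i (R, \<sigma>) = q i (\<forall>j\<in>{1..<i}. (j, i) \<in> R) (\<sigma> i))"

text \<open>
  Given the outcome \<open>\<omega>\<close>, the policy reaches round \<open>i\<close> and stops there with probability
  \<open>stop_prob r s \<pi> i \<omega>\<close>, the randomization being independent across rounds.
\<close>

definition stop_prob ::
    "(nat \<Rightarrow> 'w \<Rightarrow> nat) \<Rightarrow> (nat \<Rightarrow> 'w \<Rightarrow> 's) \<Rightarrow> (nat \<Rightarrow> (nat \<times> nat) set \<times> (nat \<Rightarrow> 's) \<Rightarrow> real)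
      \<Rightarrow> nat \<Rightarrow> 'w \<Rightarrow> real" where
  "stop_prob r s \<pi> i \<omega> = (\<Prod>j\<in>{1..<i}. 1 - \<pi> j (info r s j \<omega>)) * \<pi> i (info r s i \<omega>)"

definition win_prob ::
    "nat \<Rightarrow> 'w measure \<Rightarrow> (nat \<Rightarrow> 'w \<Rightarrow> nat) \<Rightarrow> (nat \<Rightarrow> 'w \<Rightarrow> 's)
      \<Rightarrow> (nat \<Rightarrow> (nat \<times> nat) set \<times> (nat \<Rightarrow> 's) \<Rightarrow> real) \<Rightarrow> real" where
  "win_prob n M r s \<pi> =
     (\<integral>\<omega>. (\<Sum>i\<in>{1..n}. if r i \<omega> = n then stop_prob r s \<pi> i \<omega> else 0) \<partial>M)"

end

theory Submission
  imports Defs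
begin

text \<open>
  Let \<open>T\<^sub>i\<close> be the best-so-far event and \<open>g\<^sub>i(s\<^sub>i) = P(r\<^sub>i = n | T\<^sub>i, s\<^sub>i)\<close>, and define by backward recursion
  \<open>v\<^sub>i = max 0 (g\<^sub>i - f\<^sub>i)\<close> and \<open>f\<^sub>i(s\<^sub>i) = E[\<Sum>k>i. 1\<^sub>T\<^sub>k v\<^sub>k(s\<^sub>k) | T\<^sub>i, s\<^sub>i]\<close>. Given the whole history at round
  \<open>i\<close>, the winning probability on \<open>T\<^sub>i\<close> is still \<open>g\<^sub>i(s\<^sub>i)\<close> by History-Irrelevance, and the conditional
  expectation of the sum is still \<open>f\<^sub>i(s\<^sub>i)\<close> by Non-Filtering, applied to each \<open>k\<close> separately. So a
  policy that stops at \<open>i\<close> with probability \<open>P\<^sub>i\<close> wins with probability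
  \<open>E[\<Sum>i. P\<^sub>i 1\<^sub>T\<^sub>i (g\<^sub>i - f\<^sub>i + \<Sum>k>i. 1\<^sub>T\<^sub>k v\<^sub>k)] \<le> E[\<Sum>i. P\<^sub>i (\<Sum>k\<ge>i. 1\<^sub>T\<^sub>k v\<^sub>k)] \<le> E[\<Sum>k. 1\<^sub>T\<^sub>k v\<^sub>k]\<close>,
  the last step because \<open>(\<Sum>i\<le>k. P\<^sub>i) \<le> 1\<close>. Both inequalities are equalities for the memoryless policy
  that stops at \<open>i\<close> iff \<open>T\<^sub>i\<close> occurs and \<open>g\<^sub>i(s\<^sub>i) > f\<^sub>i(s\<^sub>i)\<close>.
\<close>

section \<open>Conditional expectations as functions of the conditioning variable\<close>

text \<open>Doob-Dynkin factorization. Induction over simple functions and their monotone limits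
  works for an arbitrary \<open>N\<close> because in \<open>ennreal\<close> the supremum of the
  chosen factors always exists, even at points outside the range of \<open>Y\<close>.\<close>

lemma vimage_algebra_factor_ennreal:
  fixes f :: "'a \<Rightarrow> ennreal"
  assumes Y: "Y \<in> X \<rightarrow> space N" and f: "f \<in> borel_measurable (vimage_algebra X Y N)"
  shows "\<exists>g\<in>borel_measurable N. \<forall>x\<in>X. f x = g (Y x)"
  using f
proof (induction rule: borel_measurable_induct)
  case (cong f g)
  from cong.IH obtain h where h: "h \<in> borel_measurable N" "\<forall>x\<in>X. g x = h (Y x)" by blast
  have "\<forall>x\<in>X. f x = h (Y x)"
    using cong.hyps h(2) by simp
  with h(1) show ?case by blast
next
  case (set A)
  then obtain B where B: "B \<in> sets N" "A = Y -` B \<inter> X"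
    unfolding sets_vimage_algebra2[OF Y] by auto
  have "\<forall>x\<in>X. indicator A x = (indicator B (Y x) :: ennreal)"
    unfolding B(2) by (simp split: split_indicator)
  moreover have "(indicator B :: _ \<Rightarrow> ennreal) \<in> borel_measurable N"
    using B(1) by (rule borel_measurable_indicator)
  ultimately show ?case by blast
next
  case (mult u c)
  from mult.IH obtain g where g: "g \<in> borel_measurable N" "\<forall>x\<in>X. u x = g (Y x)" by blast
  have "(\<lambda>y. c * g y) \<in> borel_measurable N" using g(1) by measurable
  with g(2) show ?case by (intro bexI[of _ "\<lambda>y. c * g y"]) simp_all
next
  case (add u v)
  from add.IH(1) obtain g where g: "g \<in> borel_measurable N" "\<forall>x\<in>X. u x = g (Y x)" by blast
  from add.IH(2) obtain h where h: "h \<in> borel_measurable N" "\<forall>x\<in>X. v x = h (Y x)" by blast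
  have "(\<lambda>y. h y + g y) \<in> borel_measurable N" using g(1) h(1) by measurable
  with g(2) h(2) show ?case by (intro bexI[of _ "\<lambda>y. h y + g y"]) simp_all
next
  case (seq U)
  have "\<forall>i. \<exists>g. g \<in> borel_measurable N \<and> (\<forall>x\<in>X. U i x = g (Y x))"
    using seq.IH by blast
  from choice[OF this] obtain g
    where g: "\<forall>i. g i \<in> borel_measurable N \<and> (\<forall>x\<in>X. U i x = g i (Y x))" ..
  have "(\<lambda>y. SUP i. g i y) \<in> borel_measurable N"
    using g by (intro borel_measurable_SUP) auto
  moreover have "\<forall>x\<in>X. (SUP i. U i) x = (SUP i. g i (Y x))"
    using g by (simp add: image_comp)
  ultimately show ?case by (intro bexI[of _ "\<lambda>y. SUP i. g i y"]) simp_all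
qed

lemma (in prob_space) integral_uniform_measure:
  fixes f :: "'a \<Rightarrow> real"
  assumes E: "E \<in> events" "prob E \<noteq> 0" and f: "f \<in> borel_measurable M"
  shows "(\<integral>x. f x \<partial>uniform_measure M E) = (\<integral>x. indicator E x * f x \<partial>M) / prob E"
proof -
  have pos: "0 < prob E" using E(2) measure_nonneg[of M E] by linarith
  have "uniform_measure M E = density M (\<lambda>x. ennreal (indicator E x / prob E))"
    unfolding uniform_measure_def
    using pos by (intro arg_cong[where f = "density M"] ext)
      (auto simp: emeasure_eq_measure divide_ennreal[symmetric] indicator_def)
  then have "(\<integral>x. f x \<partial>uniform_measure M E) = (\<integral>x. (indicator E x / prob E) * f x \<partial>M)"
    using integral_density[OF f, of "\<lambda>x. indicator E x / prob E"] E by simp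
  also have "\<dots> = (\<integral>x. (indicator E x * f x) / prob E \<partial>M)"
    by (intro Bochner_Integration.integral_cong) auto
  finally show ?thesis by simp
qed

text \<open>Covers null \<open>E\<close> as well: the conditioned measure is then zero and says
  nothing, but the implication is trivial off \<open>E\<close>, hence almost everywhere.\<close>

lemma (in prob_space) AE_uniform_measureD:
  assumes E: "E \<in> events" and "AE x in uniform_measure M E. P x"
  shows "AE x in M. x \<in> E \<longrightarrow> P x"
proof (cases "prob E = 0")
  case True
  then have "E \<in> null_sets M" using E by (simp add: null_sets_def emeasure_eq_measure)
  then show ?thesis using AE_not_in by fastforce
next
  case False
  then show ?thesis
    using assms by (subst (asm) AE_uniform_measure) (auto simp: emeasure_eq_measure)
qed

lemma (in prob_space) integrable_bounded:
  fixes f :: "'a \<Rightarrow> real"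
  assumes "f \<in> borel_measurable M" "\<And>x. x \<in> space M \<Longrightarrow> \<bar>f x\<bar> \<le> C"
  shows "integrable M f"
  using assms by (intro integrable_const_bound[where B = C]) auto

lemma subalgebra_vimage:
  assumes "Y \<in> measurable M N"
  shows "subalgebra M (vimage_algebra (space M) Y N)"
proof -
  have "Y \<in> space M \<rightarrow> space N" using assms by (auto dest: measurable_space)
  with assms show ?thesis
    unfolding subalgebra_def by (auto simp: sets_vimage_algebra2 measurable_sets)
qed

text \<open>Replaces the conditional expectation behind \<open>cond_pr\<close> by a function of the
  value of \<open>Y\<close> with bounds at every point. Its defining property becomes an identity of
  integrals over \<open>M\<close>, so that later arguments can mix different conditionings without
  changing the measure.\<close>

lemma (in prob_space) cond_exp_factor:
  fixes F :: "'a \<Rightarrow> real"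
  assumes E: "E \<in> events" and Y[measurable]: "Y \<in> measurable M N"
    and F[measurable]: "F \<in> borel_measurable M" and F01: "\<And>x. 0 \<le> F x \<and> F x \<le> 1"
  obtains \<phi> where "\<phi> \<in> borel_measurable N" "\<And>y. 0 \<le> \<phi> y \<and> \<phi> y \<le> 1"
    "AE x in M. x \<in> E \<longrightarrow>
       real_cond_exp (uniform_measure M E) (vimage_algebra (space M) Y N) F x = \<phi> (Y x)"
    "\<And>h C. h \<in> borel_measurable N \<Longrightarrow> (\<And>y. \<bar>h y\<bar> \<le> C) \<Longrightarrow>
       (\<integral>x. indicator E x * h (Y x) * \<phi> (Y x) \<partial>M) = (\<integral>x. indicator E x * h (Y x) * F x \<partial>M)"
proof (cases "prob E = 0")
  case True
  then have "E \<in> null_sets M" using E by (simp add: null_sets_def emeasure_eq_measure)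
  then have ae: "AE x in M. x \<notin> E" by (rule AE_not_in)
  have z: "(\<integral>x. indicator E x * h x * k x \<partial>M) = 0" for h k :: "'a \<Rightarrow> real"
    by (rule integral_eq_zero_AE) (use ae in auto)
  show thesis
    by (rule that[of "\<lambda>_. 0"]) (use ae in \<open>auto simp: z\<close>)
next
  case False
  note [measurable] = E
  let ?U = "uniform_measure M E" and ?V = "vimage_algebra (space M) Y N"
  interpret U: prob_space ?U
    using False by (intro prob_space_uniform_measure) (auto simp: emeasure_eq_measure)
  have Ysp: "Y \<in> space M \<rightarrow> space N" using measurable_space[OF Y] by auto
  have sub: "subalgebra ?U ?V"
    using subalgebra_vimage[OF Y] by (simp add: subalgebra_def)
  interpret C: finite_measure_subalgebra ?U ?V
    by unfold_locales (rule sub)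
  have FU: "F \<in> borel_measurable ?U" by simp
  have intF: "integrable ?U F"
    by (rule U.integrable_bounded[where C = 1]) (use F01 in auto)
  let ?c = "real_cond_exp ?U ?V F"
  have c0: "AE x in ?U. 0 \<le> ?c x"
    by (rule C.real_cond_exp_ge_c[OF intF]) (use F01 in auto)
  have c1: "AE x in ?U. ?c x \<le> 1"
    by (rule C.real_cond_exp_le_c[OF intF]) (use F01 in auto)
  have "(\<lambda>x. ennreal (?c x)) \<in> borel_measurable ?V" by measurable
  from vimage_algebra_factor_ennreal[OF Ysp this]
  obtain g where g[measurable]: "g \<in> borel_measurable N"
    and gc: "\<And>x. x \<in> space M \<Longrightarrow> ennreal (?c x) = g (Y x)" by auto
  \<comment> \<open>Since \<open>ennreal\<close> truncates negative numbers, \<open>g\<close>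
    recovers \<open>?c\<close> only where \<open>?c\<close> is nonnegative, which is almost
    everywhere. Clipping makes the bounds hold for all \<open>y\<close>, including values that
    \<open>Y\<close> never takes.\<close>
  define \<phi> where "\<phi> y = max 0 (min 1 (enn2real (g y)))" for y
  have \<phi>[measurable]: "\<phi> \<in> borel_measurable N" unfolding \<phi>_def by measurable
  have \<phi>01: "0 \<le> \<phi> y \<and> \<phi> y \<le> 1" for y by (auto simp: \<phi>_def)
  have aeU: "AE x in ?U. ?c x = \<phi> (Y x)"
    using c0 c1 AE_space
  proof eventually_elim
    case (elim x)
    then have "enn2real (g (Y x)) = ?c x" by (subst gc[symmetric]) auto
    with elim show ?case by (simp add: \<phi>_def)
  qed
  show thesis
  proof (rule that[OF \<phi> \<phi>01])
    show "AE x in M. x \<in> E \<longrightarrow> ?c x = \<phi> (Y x)"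
      by (rule AE_uniform_measureD[OF E aeU])
    fix h :: "'b \<Rightarrow> real" and C assume h[measurable]: "h \<in> borel_measurable N" and C: "\<And>y. \<bar>h y\<bar> \<le> C"
    have hV: "(\<lambda>x. h (Y x)) \<in> borel_measurable ?V"
      using measurable_vimage_algebra1[OF Ysp] by measurable
    have int: "integrable ?U (\<lambda>x. h (Y x) * F x)"
    proof (rule U.integrable_bounded[where C = C])
      show "(\<lambda>x. h (Y x) * F x) \<in> borel_measurable ?U" by simp
      fix x
      have "\<bar>h (Y x) * F x\<bar> \<le> C * 1"
        unfolding abs_mult using C F01[of x] by (intro mult_mono) (auto intro: order_trans[OF abs_ge_zero C])
      then show "\<bar>h (Y x) * F x\<bar> \<le> C" by simp
    qed
    have "(\<integral>x. h (Y x) * \<phi> (Y x) \<partial>?U) = (\<integral>x. h (Y x) * ?c x \<partial>?U)"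
      by (rule integral_cong_AE) (use aeU in \<open>auto simp: measurable_from_subalg[OF sub]\<close>)
    also have "\<dots> = (\<integral>x. h (Y x) * F x \<partial>?U)"
      by (rule C.real_cond_exp_intg(2)[OF int hV FU])
    finally show "(\<integral>x. indicator E x * h (Y x) * \<phi> (Y x) \<partial>M) = (\<integral>x. indicator E x * h (Y x) * F x \<partial>M)"
      using False E by (simp add: integral_uniform_measure mult.assoc)
  qed
qed

text \<open>Non-Filtering and History-Irrelevance speak of events, while stopping probabilities are
  functions. Equality of integrals over all events of \<open>F\<close> makes the conditional
  expectation of \<open>f - g\<close> vanish, and pulling out \<open>X\<close> extends the equality
  to bounded weights.\<close>

lemma (in prob_space) integral_mult_eq_of_subalgebra:
  fixes f g X :: "'a \<Rightarrow> real"
  assumes sub: "subalgebra M F" and f: "integrable M f" and g: "integrable M g"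
    and eq: "\<And>A. A \<in> sets F \<Longrightarrow> (\<integral>x. indicator A x * f x \<partial>M) = (\<integral>x. indicator A x * g x \<partial>M)"
    and X: "X \<in> borel_measurable F" and bound: "\<And>x. x \<in> space M \<Longrightarrow> \<bar>X x\<bar> \<le> C"
  shows "(\<integral>x. X x * f x \<partial>M) = (\<integral>x. X x * g x \<partial>M)"
proof -
  interpret C: finite_measure_subalgebra M F by unfold_locales (rule sub)
  have XM[measurable]: "X \<in> borel_measurable M" by (rule measurable_from_subalg[OF sub X])
  have int: "integrable M (\<lambda>x. X x * h x)" if h: "integrable M h" for h :: "'a \<Rightarrow> real"
  proof (rule Bochner_Integration.integrable_bound)
    show "integrable M (\<lambda>x. C * h x)" using h by simp
    show "(\<lambda>x. X x * h x) \<in> borel_measurable M" using h by measurable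
    show "AE x in M. norm (X x * h x) \<le> norm (C * h x)"
      using bound by (intro AE_I2) (force simp: abs_mult intro!: mult_right_mono)
  qed
  have "AE x in M. real_cond_exp M F (\<lambda>x. f x - g x) x = 0"
  proof (rule C.real_cond_exp_charact)
    fix A assume A: "A \<in> sets F"
    then have "A \<in> events" using sub by (auto simp: subalgebra_def)
    then have i: "integrable M (\<lambda>x. indicator A x * f x)" "integrable M (\<lambda>x. indicator A x * g x)"
      using f g by (auto simp: integrable_real_mult_indicator mult.commute)
    have "(\<integral>x\<in>A. f x - g x \<partial>M) = (\<integral>x. indicator A x * f x - indicator A x * g x \<partial>M)"
      by (simp add: set_lebesgue_integral_def right_diff_distrib)
    then show "(\<integral>x\<in>A. f x - g x \<partial>M) = (\<integral>x\<in>A. 0 \<partial>M)"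
      using eq[OF A] i by (simp add: set_lebesgue_integral_def)
  qed (use f g in auto)
  then have "(\<integral>x. X x * real_cond_exp M F (\<lambda>x. f x - g x) x \<partial>M) = 0"
    by (intro integral_eq_zero_AE) auto
  also have "(\<integral>x. X x * real_cond_exp M F (\<lambda>x. f x - g x) x \<partial>M) = (\<integral>x. X x * (f x - g x) \<partial>M)"
    using f g X by (intro C.real_cond_exp_intg(2) int) auto
  finally show ?thesis using int[OF f] int[OF g] by (simp add: right_diff_distrib)
qed

section \<open>Summation identities for randomized stopping\<close>

text \<open>Telescoping: each term is the probability of surviving the rounds before
  \<open>i\<close> minus that of also surviving round \<open>i\<close>.\<close>

lemma sum_stopping_eq:
  fixes p :: "nat \<Rightarrow> real"
  shows "(\<Sum>i\<in>{1..m}. (\<Prod>j\<in>{1..<i}. 1 - p j) * p i) = 1 - (\<Prod>j\<in>{1..m}. 1 - p j)"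
proof (induction m)
  case (Suc m)
  have "{1..<Suc m} = {1..m}" by auto
  with Suc show ?case by (simp add: algebra_simps)
qed simp

text \<open>After exchanging the sums, \<open>c k\<close> is collected by every stopping round
  \<open>i \<le> k\<close>, so its total weight is the probability of having stopped by round
  \<open>k\<close>.\<close>

lemma sum_stopping_tail_eq:
  fixes p c :: "nat \<Rightarrow> real"
  shows "(\<Sum>i\<in>{1..n}. (\<Prod>j\<in>{1..<i}. 1 - p j) * p i * (\<Sum>k\<in>{i..n}. c k))
       = (\<Sum>k\<in>{1..n}. c k * (1 - (\<Prod>j\<in>{1..k}. 1 - p j)))"
proof -
  have "{k. k \<in> {1..n} \<and> i \<le> k} = {i..n}" if "i \<in> {1..n}" for i
    using that by auto
  then have "(\<Sum>i\<in>{1..n}. (\<Prod>j\<in>{1..<i}. 1 - p j) * p i * (\<Sum>k\<in>{i..n}. c k))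
     = (\<Sum>i\<in>{1..n}. \<Sum>k | k \<in> {1..n} \<and> i \<le> k. c k * ((\<Prod>j\<in>{1..<i}. 1 - p j) * p i))"
    by (intro sum.cong refl) (simp add: sum_distrib_right[symmetric] mult.commute)
  also have "\<dots> = (\<Sum>k\<in>{1..n}. \<Sum>i | i \<in> {1..n} \<and> i \<le> k. c k * ((\<Prod>j\<in>{1..<i}. 1 - p j) * p i))"
    by (rule sum.swap_restrict) auto
  also have "\<dots> = (\<Sum>k\<in>{1..n}. c k * (\<Sum>i\<in>{1..k}. (\<Prod>j\<in>{1..<i}. 1 - p j) * p i))"
    by (intro sum.cong refl) (auto simp: sum_distrib_left intro!: sum.cong)
  finally show ?thesis by (simp only: sum_stopping_eq)
qed

section \<open>The filtration of histories and the stopping probabilities\<close>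

context secretary_advice
begin

abbreviation "hist i \<equiv> vimage_algebra (space M) (info r s i) (info_space S i)"

abbreviation "best i \<equiv> best_so_far M r i"

lemma rank_less_eq_event:
  assumes "j \<in> {1..n}" "k \<in> {1..n}"
  shows "{\<omega> \<in> space M. r j \<omega> \<le> r k \<omega>} \<in> events"
proof -
  have "(\<lambda>\<omega>. real (r i \<omega>)) \<in> borel_measurable M" if "i \<in> {1..n}" for i
    by (rule measurable_compose[OF rank_measurable[OF that]]) simp
  from borel_measurable_le[OF this[OF assms(1)] this[OF assms(2)]] show ?thesis by simp
qed

lemma best_event:
  assumes "i \<in> {1..n}"
  shows "best i \<in> events"
  unfolding best_so_far_def
  by (rule sets.sets_Collect_finite_All) (use assms in \<open>auto intro!: rank_less_eq_event\<close>)

lemma info_measurable: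
  assumes "i \<in> {1..n}"
  shows "info r s i \<in> measurable M (info_space S i)"
proof -
  let ?P = "{1..i} \<times> {1..i}"
  have mem: "p \<in> rel_order r i \<omega> \<longleftrightarrow> p \<in> ?P \<and> r (fst p) \<omega> \<le> r (snd p) \<omega>" for p \<omega>
    by (cases p) (simp add: rel_order_def)
  \<comment> \<open>\<open>Pow ?P\<close> is finite, so preimages of single orders suffice; each is
    a finite conjunction of rank comparisons and their negations.\<close>
  have "rel_order r i -` {R} \<inter> space M \<in> events" if R: "R \<in> Pow ?P" for R
  proof -
    have "rel_order r i -` {R} \<inter> space M
      = {\<omega> \<in> space M. \<forall>p\<in>?P. (r (fst p) \<omega> \<le> r (snd p) \<omega>) = (p \<in> R)}"
      using R mem by blast
    also have "\<dots> \<in> events"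
    proof (rule sets.sets_Collect_finite_All)
      fix p assume "p \<in> ?P"
      then have "{\<omega> \<in> space M. r (fst p) \<omega> \<le> r (snd p) \<omega>} \<in> events"
        using assms by (intro rank_less_eq_event) auto
      then show "{\<omega> \<in> space M. (r (fst p) \<omega> \<le> r (snd p) \<omega>) = (p \<in> R)} \<in> events"
        by (cases "p \<in> R") (auto dest: sets.sets_Collect_neg)
    qed (use assms in auto)
    finally show ?thesis .
  qed
  then have "rel_order r i \<in> measurable M (count_space (Pow ?P))"
    using mem by (subst measurable_count_space_eq2) blast+
  moreover have "(\<lambda>\<omega>. \<lambda>j\<in>{1..i}. s j \<omega>) \<in> measurable M (\<Pi>\<^sub>M j\<in>{1..i}. S)"
    using assms by (intro measurable_restrict signal_measurable) auto
  ultimately show ?thesis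
    unfolding info_space_def info_def by measurable
qed

text \<open>Nothing is forgotten: restricting the order and the signals to the first
  \<open>j\<close> rounds recovers the earlier information, so the algebras \<open>hist\<close>
  increase.\<close>

lemma info_hist_measurable:
  assumes "j \<le> i" "i \<in> {1..n}"
  shows "info r s j \<in> measurable (hist i) (info_space S j)"
proof -
  define restr :: "(nat \<times> nat) set \<times> (nat \<Rightarrow> 's) \<Rightarrow> (nat \<times> nat) set \<times> (nat \<Rightarrow> 's)"
    where "restr x = (fst x \<inter> {1..j} \<times> {1..j}, restrict (snd x) {1..j})" for x
  have "(\<lambda>R. R \<inter> {1..j} \<times> {1..j})
      \<in> measurable (count_space (Pow ({1..i} \<times> {1..i}))) (count_space (Pow ({1..j} \<times> {1..j})))"
    by auto
  moreover have "(\<lambda>\<sigma>. restrict \<sigma> {1..j}) \<in> measurable (\<Pi>\<^sub>M j\<in>{1..i}. S) (\<Pi>\<^sub>M j\<in>{1..j}. S)"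
    using assms by (intro measurable_restrict_subset) auto
  ultimately have "restr \<in> measurable (info_space S i) (info_space S j)"
    unfolding restr_def info_space_def by measurable
  moreover have "info r s i \<in> measurable (hist i) (info_space S i)"
    using info_measurable[OF assms(2)]
    by (intro measurable_vimage_algebra1) (auto dest: measurable_space)
  ultimately have "(\<lambda>\<omega>. restr (info r s i \<omega>)) \<in> measurable (hist i) (info_space S j)"
    by measurable
  also have "(\<lambda>\<omega>. restr (info r s i \<omega>)) = info r s j"
    using assms by (auto simp: restr_def info_def rel_order_def fun_eq_iff restrict_def)
  finally show ?thesis .
qed

lemma hist_sets:
  assumes "i \<in> {1..n}"
  shows "sets (hist i) = {{\<omega> \<in> space M. info r s i \<omega> \<in> B} | B. B \<in> sets (info_space S i)}"
proof -
  have "info r s i \<in> space M \<rightarrow> space (info_space S i)"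
    using info_measurable[OF assms] by (auto dest: measurable_space)
  then show ?thesis
    by (subst sets_vimage_algebra2) (auto simp: vimage_def Int_def conj_commute)
qed

lemma policy_bounds:
  assumes "policy n S \<pi>" "i \<in> {1..n}" "\<omega> \<in> space M"
  shows "0 \<le> \<pi> i (info r s i \<omega>)" "\<pi> i (info r s i \<omega>) \<le> 1"
  using assms measurable_space[OF info_measurable[OF assms(2)] assms(3)]
  by (auto simp: policy_def)

text \<open>Stopping at \<open>i\<close> involves all earlier decisions, and these are determined by
  the information at \<open>i\<close>. This admits \<open>stop_prob\<close> as a weight
  \<open>X\<close> in conditional expectations given the history.\<close>

lemma stop_prob_hist_measurable:
  assumes "policy n S \<pi>" "i \<in> {1..n}"
  shows "stop_prob r s \<pi> i \<in> borel_measurable (hist i)"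
proof -
  have *: "(\<lambda>\<omega>. \<pi> j (info r s j \<omega>)) \<in> borel_measurable (hist i)" if "j \<in> {1..i}" for j
  proof (rule measurable_compose[OF info_hist_measurable])
    show "\<pi> j \<in> borel_measurable (info_space S j)"
      using assms that by (auto simp: policy_def)
  qed (use assms that in auto)
  show ?thesis
    unfolding stop_prob_def
    using assms(2) by (intro borel_measurable_times borel_measurable_prod borel_measurable_diff *) auto
qed

lemma stop_prob_bounds:
  assumes "policy n S \<pi>" "i \<in> {1..n}" "\<omega> \<in> space M"
  shows "0 \<le> stop_prob r s \<pi> i \<omega>" "stop_prob r s \<pi> i \<omega> \<le> 1"
proof -
  have "0 \<le> (\<Prod>j\<in>{1..<i}. 1 - \<pi> j (info r s j \<omega>))" "(\<Prod>j\<in>{1..<i}. 1 - \<pi> j (info r s j \<omega>)) \<le> 1"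
    using assms policy_bounds[OF assms(1) _ assms(3)]
    by (auto intro!: prod_nonneg prod_le_1)
  then show "0 \<le> stop_prob r s \<pi> i \<omega>" "stop_prob r s \<pi> i \<omega> \<le> 1"
    using policy_bounds[OF assms] by (auto simp: stop_prob_def intro: mult_le_one)
qed

section \<open>What History-Irrelevance and Non-Filtering say about values given the history\<close>

lemma win_subset_best:
  assumes "i \<in> {1..n}" "\<omega> \<in> space M" "r i \<omega> = n"
  shows "\<omega> \<in> best i"
  using assms rank_range by (auto simp: best_so_far_def)

text \<open>\<open>\<phi> (s i)\<close> on \<open>best i\<close>, and \<open>0\<close> elsewhere, is a version of the conditional expectation of
  \<open>F\<close> given the information at round \<open>i\<close>.\<close>

definition memoryless_value :: "nat \<Rightarrow> ('w \<Rightarrow> real) \<Rightarrow> ('s \<Rightarrow> real) \<Rightarrow> bool" where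
  "memoryless_value i F \<phi> \<longleftrightarrow> \<phi> \<in> borel_measurable S \<and>
    (\<forall>X\<in>borel_measurable (hist i). (\<forall>\<omega>\<in>space M. 0 \<le> X \<omega> \<and> X \<omega> \<le> 1) \<longrightarrow>
      (\<integral>\<omega>. X \<omega> * F \<omega> \<partial>M) = (\<integral>\<omega>. X \<omega> * (indicator (best i) \<omega> * \<phi> (s i \<omega>)) \<partial>M))"

lemma memoryless_value_measurable: "memoryless_value i F \<phi> \<Longrightarrow> \<phi> \<in> borel_measurable S"
  by (simp add: memoryless_value_def)

lemma memoryless_value_integral:
  assumes "memoryless_value i F \<phi>" "X \<in> borel_measurable (hist i)"
    and "\<And>\<omega>. \<omega> \<in> space M \<Longrightarrow> 0 \<le> X \<omega> \<and> X \<omega> \<le> 1"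
  shows "(\<integral>\<omega>. X \<omega> * F \<omega> \<partial>M) = (\<integral>\<omega>. X \<omega> * (indicator (best i) \<omega> * \<phi> (s i \<omega>)) \<partial>M)"
  using assms unfolding memoryless_value_def by simp

text \<open>Let \<open>g\<close> be the conditional probability of a win given the best-so-far event
  and the signal. History-Irrelevance factors the probability of \<open>A \<inter> ?W\<close>
  through \<open>g\<close>, so knowing the whole history does not change the chance of
  winning.\<close>

lemma win_factor:
  assumes HI: "history_irrelevance n M r S s" and i: "i \<in> {1..n}"
  shows "\<exists>g. memoryless_value i (indicator {\<omega> \<in> space M. r i \<omega> = n}) g \<and> (\<forall>y. 0 \<le> g y \<and> g y \<le> 1)"
proof -
  let ?W = "{\<omega> \<in> space M. r i \<omega> = n}"
  note [measurable] = best_event[OF i] signal_measurable[OF i] info_measurable[OF i]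
    rank_measurable[OF i]
  have W[measurable]: "?W \<in> events" by measurable
  obtain g where g[measurable]: "g \<in> borel_measurable S" and g01: "\<And>y. 0 \<le> g y \<and> g y \<le> 1"
    and g_ae: "AE \<omega> in M. \<omega> \<in> best i \<longrightarrow> cond_pr M (best i) (s i) S ?W \<omega> = g (s i \<omega>)"
    unfolding cond_pr_def
    by (rule cond_exp_factor[OF best_event[OF i] signal_measurable[OF i], of "indicator ?W"]) auto
  have "(\<integral>\<omega>. X \<omega> * indicator ?W \<omega> \<partial>M) = (\<integral>\<omega>. X \<omega> * (indicator (best i) \<omega> * g (s i \<omega>)) \<partial>M)"
    if X: "X \<in> borel_measurable (hist i)" "\<forall>\<omega>\<in>space M. 0 \<le> X \<omega> \<and> X \<omega> \<le> 1" for X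
  proof (rule integral_mult_eq_of_subalgebra[OF subalgebra_vimage _ _ _ X(1), where C = 1])
    show "integrable M (indicator ?W :: _ \<Rightarrow> real)"
      by (rule integrable_bounded[where C = 1]) auto
    show "integrable M (\<lambda>\<omega>. indicator (best i) \<omega> * g (s i \<omega>))"
      by (rule integrable_bounded[where C = 1]) (use g01 in \<open>auto simp: indicator_def\<close>)
    \<comment> \<open>It suffices to test against history events, which are the events that the
      hypothesis controls. Below, \<open>\<alpha>\<close> and \<open>\<beta>\<close> represent the
      conditional probabilities of \<open>A\<close> and of \<open>A \<inter> ?W\<close>.\<close>
    fix A assume "A \<in> sets (hist i)"
    then obtain B where B: "B \<in> sets (info_space S i)" and A: "A = {\<omega> \<in> space M. info r s i \<omega> \<in> B}"
      by (auto simp: hist_sets[OF i])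
    have [measurable]: "A \<in> events" unfolding A using B by measurable
    obtain \<alpha> where \<alpha>[measurable]: "\<alpha> \<in> borel_measurable S" and \<alpha>01: "\<And>y. 0 \<le> \<alpha> y \<and> \<alpha> y \<le> 1"
      and \<alpha>_ae: "AE \<omega> in M. \<omega> \<in> best i \<longrightarrow> cond_pr M (best i) (s i) S A \<omega> = \<alpha> (s i \<omega>)"
      and \<alpha>_int: "\<And>h C. h \<in> borel_measurable S \<Longrightarrow> (\<And>y. \<bar>h y\<bar> \<le> C) \<Longrightarrow>
       (\<integral>x. indicator (best i) x * h (s i x) * \<alpha> (s i x) \<partial>M)
       = (\<integral>x. indicator (best i) x * h (s i x) * indicator A x \<partial>M)"
      unfolding cond_pr_def
      by (rule cond_exp_factor[OF best_event[OF i] signal_measurable[OF i], of "indicator A"]) auto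
    obtain \<beta> where \<beta>[measurable]: "\<beta> \<in> borel_measurable S"
      and \<beta>_ae: "AE \<omega> in M. \<omega> \<in> best i \<longrightarrow> cond_pr M (best i) (s i) S (A \<inter> ?W) \<omega> = \<beta> (s i \<omega>)"
      and \<beta>_int: "\<And>h C. h \<in> borel_measurable S \<Longrightarrow> (\<And>y. \<bar>h y\<bar> \<le> C) \<Longrightarrow>
       (\<integral>x. indicator (best i) x * h (s i x) * \<beta> (s i x) \<partial>M)
       = (\<integral>x. indicator (best i) x * h (s i x) * indicator (A \<inter> ?W) x \<partial>M)"
      unfolding cond_pr_def
      by (rule cond_exp_factor[OF best_event[OF i] signal_measurable[OF i], of "indicator (A \<inter> ?W)"]) auto
    have "AE \<omega> in uniform_measure M (best i). cond_pr M (best i) (s i) S (A \<inter> ?W) \<omega>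
             = cond_pr M (best i) (s i) S A \<omega> * cond_pr M (best i) (s i) S ?W \<omega>"
      using HI i B by (simp add: history_irrelevance_def Let_def A)
    then have HI': "AE \<omega> in M. \<omega> \<in> best i \<longrightarrow> cond_pr M (best i) (s i) S (A \<inter> ?W) \<omega>
             = cond_pr M (best i) (s i) S A \<omega> * cond_pr M (best i) (s i) S ?W \<omega>"
      by (rule AE_uniform_measureD[OF best_event[OF i]])
    \<comment> \<open>The factor \<open>indicator (best i)\<close> comes for free: ranks never
      exceed \<open>n\<close>, so a win is always best so far.\<close>
    have "(\<integral>\<omega>. indicator A \<omega> * indicator ?W \<omega> \<partial>M) = (\<integral>\<omega>. indicator (best i) \<omega> * (1::real) * indicator (A \<inter> ?W) \<omega> \<partial>M)"
      using win_subset_best[OF i] by (intro Bochner_Integration.integral_cong) (auto simp: indicator_def)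
    also have "\<dots> = (\<integral>\<omega>. indicator (best i) \<omega> * 1 * \<beta> (s i \<omega>) \<partial>M)"
      by (rule \<beta>_int[of "\<lambda>_. 1" 1, symmetric]) auto
    \<comment> \<open>History-Irrelevance turns \<open>\<beta>\<close> into the product of
      \<open>g\<close> and \<open>\<alpha>\<close>; then \<open>g\<close>, a function of the signal,
      serves as the weight that trades \<open>\<alpha>\<close> for \<open>A\<close>.\<close>
    also have "\<dots> = (\<integral>\<omega>. indicator (best i) \<omega> * g (s i \<omega>) * \<alpha> (s i \<omega>) \<partial>M)"
      by (rule integral_cong_AE) (use HI' \<alpha>_ae \<beta>_ae g_ae in \<open>auto simp: indicator_def\<close>)
    also have "\<dots> = (\<integral>\<omega>. indicator (best i) \<omega> * g (s i \<omega>) * indicator A \<omega> \<partial>M)"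
      using g01 by (intro \<alpha>_int[of g 1]) auto
    finally show "(\<integral>\<omega>. indicator A \<omega> * indicator ?W \<omega> \<partial>M)
        = (\<integral>\<omega>. indicator A \<omega> * (indicator (best i) \<omega> * g (s i \<omega>)) \<partial>M)"
      by (simp add: mult_ac)
  qed (use X(2) in auto)
  then show ?thesis using g g01 unfolding memoryless_value_def by blast
qed

text \<open>By Non-Filtering, a history event at \<open>j\<close> has the same conditional
  probability whether or not the best-so-far event and signal of round \<open>i\<close> are also
  known. Read backwards, on \<open>best j\<close> the history adds nothing to \<open>s j\<close> in
  predicting a reward that depends only on that event and signal.\<close>

lemma future_factor:
  assumes NF: "non_filtering n M r S s" and i: "i \<in> {1..n}" and j: "j \<in> {1..<i}"
    and u[measurable]: "(u :: 's \<Rightarrow> real) \<in> borel_measurable S" and u01: "\<And>y. 0 \<le> u y \<and> u y \<le> 1"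
  shows "\<exists>\<phi>. memoryless_value j (\<lambda>\<omega>. indicator (best j) \<omega> * (indicator (best i) \<omega> * u (s i \<omega>))) \<phi> \<and>
    (\<forall>y. 0 \<le> \<phi> y \<and> \<phi> y \<le> 1)"
proof -
  have j': "j \<in> {1..n}" using i j by auto
  let ?E = "best j \<inter> best i"
  note [measurable] = best_event[OF i] signal_measurable[OF i]
    best_event[OF j'] signal_measurable[OF j'] info_measurable[OF j']
  have E[measurable]: "?E \<in> events" by measurable
  have Y: "(\<lambda>\<omega>. (s j \<omega>, s i \<omega>)) \<in> measurable M (S \<Otimes>\<^sub>M S)" by measurable
  let ?F = "\<lambda>\<omega>. indicat_real (best i) \<omega> * u (s i \<omega>)"
  obtain \<phi> where \<phi>[measurable]: "\<phi> \<in> borel_measurable S" and \<phi>01: "\<And>y. 0 \<le> \<phi> y \<and> \<phi> y \<le> 1"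
    and \<phi>_int: "\<And>h C. h \<in> borel_measurable S \<Longrightarrow> (\<And>y. \<bar>h y\<bar> \<le> C) \<Longrightarrow>
       (\<integral>x. indicator (best j) x * h (s j x) * \<phi> (s j x) \<partial>M)
       = (\<integral>x. indicator (best j) x * h (s j x) * ?F x \<partial>M)"
    by (rule cond_exp_factor[OF best_event[OF j'] signal_measurable[OF j'], of ?F])
      (use u01 in \<open>auto simp: indicator_def\<close>)
  have "(\<integral>\<omega>. X \<omega> * (indicator (best j) \<omega> * ?F \<omega>) \<partial>M) = (\<integral>\<omega>. X \<omega> * (indicator (best j) \<omega> * \<phi> (s j \<omega>)) \<partial>M)"
    if X: "X \<in> borel_measurable (hist j)" "\<forall>\<omega>\<in>space M. 0 \<le> X \<omega> \<and> X \<omega> \<le> 1" for X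
  proof (rule integral_mult_eq_of_subalgebra[OF subalgebra_vimage _ _ _ X(1), where C = 1])
    show "integrable M (\<lambda>\<omega>. indicator (best j) \<omega> * ?F \<omega>)"
      by (rule integrable_bounded[where C = 1]) (use u01 in \<open>auto simp: indicator_def\<close>)
    show "integrable M (\<lambda>\<omega>. indicator (best j) \<omega> * \<phi> (s j \<omega>))"
      by (rule integrable_bounded[where C = 1]) (use \<phi>01 in \<open>auto simp: indicator_def\<close>)
    fix A assume "A \<in> sets (hist j)"
    then obtain B where B: "B \<in> sets (info_space S j)" and A: "A = {\<omega> \<in> space M. info r s j \<omega> \<in> B}"
      by (auto simp: hist_sets[OF j'])
    have [measurable]: "A \<in> events" unfolding A using B by measurable
    obtain \<alpha> where \<alpha>[measurable]: "\<alpha> \<in> borel_measurable S" and \<alpha>01: "\<And>y. 0 \<le> \<alpha> y \<and> \<alpha> y \<le> 1"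
      and \<alpha>_ae: "AE \<omega> in M. \<omega> \<in> best j \<longrightarrow> cond_pr M (best j) (s j) S A \<omega> = \<alpha> (s j \<omega>)"
      and \<alpha>_int: "\<And>h C. h \<in> borel_measurable S \<Longrightarrow> (\<And>y. \<bar>h y\<bar> \<le> C) \<Longrightarrow>
       (\<integral>x. indicator (best j) x * h (s j x) * \<alpha> (s j x) \<partial>M)
       = (\<integral>x. indicator (best j) x * h (s j x) * indicator A x \<partial>M)"
      unfolding cond_pr_def
      by (rule cond_exp_factor[OF best_event[OF j'] signal_measurable[OF j'], of "indicator A"]) auto
    obtain \<beta> where \<beta>[measurable]: "\<beta> \<in> borel_measurable (S \<Otimes>\<^sub>M S)"
      and \<beta>_ae: "AE \<omega> in M. \<omega> \<in> ?E \<longrightarrow>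
        cond_pr M ?E (\<lambda>\<omega>. (s j \<omega>, s i \<omega>)) (S \<Otimes>\<^sub>M S) A \<omega> = \<beta> (s j \<omega>, s i \<omega>)"
      and \<beta>_int: "\<And>h C. h \<in> borel_measurable (S \<Otimes>\<^sub>M S) \<Longrightarrow> (\<And>y. \<bar>h y\<bar> \<le> C) \<Longrightarrow>
       (\<integral>x. indicator ?E x * h (s j x, s i x) * \<beta> (s j x, s i x) \<partial>M)
       = (\<integral>x. indicator ?E x * h (s j x, s i x) * indicator A x \<partial>M)"
      unfolding cond_pr_def
      by (rule cond_exp_factor[OF E Y, of "indicator A"]) auto
    have "AE \<omega> in uniform_measure M ?E. cond_pr M (best j) (s j) S A \<omega>
             = cond_pr M ?E (\<lambda>\<omega>. (s j \<omega>, s i \<omega>)) (S \<Otimes>\<^sub>M S) A \<omega>"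
      using NF i j B by (simp add: non_filtering_def Let_def A)
    then have NF': "AE \<omega> in M. \<omega> \<in> ?E \<longrightarrow> cond_pr M (best j) (s j) S A \<omega>
             = cond_pr M ?E (\<lambda>\<omega>. (s j \<omega>, s i \<omega>)) (S \<Otimes>\<^sub>M S) A \<omega>"
      by (rule AE_uniform_measureD[OF E])
    have "(\<integral>\<omega>. indicator A \<omega> * (indicator (best j) \<omega> * ?F \<omega>) \<partial>M)
      = (\<integral>\<omega>. indicator ?E \<omega> * u (snd (s j \<omega>, s i \<omega>)) * indicator A \<omega> \<partial>M)"
      by (intro Bochner_Integration.integral_cong) (auto simp: indicator_def)
    \<comment> \<open>Condition on both rounds, using the reward \<open>u\<close> of the later
      signal as the weight.\<close>
    also have "\<dots> = (\<integral>\<omega>. indicator ?E \<omega> * u (snd (s j \<omega>, s i \<omega>)) * \<beta> (s j \<omega>, s i \<omega>) \<partial>M)"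
      using u01 by (intro \<beta>_int[of "\<lambda>y. u (snd y)" 1, symmetric]) auto
    \<comment> \<open>Non-Filtering: \<open>\<beta>\<close> may be replaced by
      \<open>\<alpha>\<close>, which sees the signal at \<open>j\<close> only.\<close>
    also have "\<dots> = (\<integral>\<omega>. indicator (best j) \<omega> * \<alpha> (s j \<omega>) * ?F \<omega> \<partial>M)"
      by (rule integral_cong_AE) (use NF' \<alpha>_ae \<beta>_ae in \<open>auto simp: indicator_def\<close>)
    \<comment> \<open>Both \<open>\<alpha>\<close> and \<open>\<phi>\<close> are functions of
      \<open>s j\<close>, so each can be the weight in the other's identity: first the reward
      becomes \<open>\<phi>\<close>, then \<open>\<alpha>\<close> becomes \<open>A\<close>.\<close>
    also have "\<dots> = (\<integral>\<omega>. indicator (best j) \<omega> * \<alpha> (s j \<omega>) * \<phi> (s j \<omega>) \<partial>M)"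
      using \<alpha>01 by (intro \<phi>_int[of \<alpha> 1, symmetric]) auto
    also have "\<dots> = (\<integral>\<omega>. indicator (best j) \<omega> * \<phi> (s j \<omega>) * \<alpha> (s j \<omega>) \<partial>M)"
      by (simp add: mult_ac)
    also have "\<dots> = (\<integral>\<omega>. indicator (best j) \<omega> * \<phi> (s j \<omega>) * indicator A \<omega> \<partial>M)"
      using \<phi>01 by (intro \<alpha>_int[of \<phi> 1]) auto
    finally show "(\<integral>\<omega>. indicator A \<omega> * (indicator (best j) \<omega> * ?F \<omega>) \<partial>M)
        = (\<integral>\<omega>. indicator A \<omega> * (indicator (best j) \<omega> * \<phi> (s j \<omega>)) \<partial>M)"
      by (simp add: mult_ac)
  qed (use X(2) in auto)
  then show ?thesis using \<phi> \<phi>01 unfolding memoryless_value_def by blast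
qed

section \<open>Backward recursion for the continuation values\<close>

text \<open>A relation instead of a recursive function, because conditional expectations are unique
  only up to null sets and versions have to be chosen. The sum reads \<open>f\<close> at later
  rounds only.\<close>

definition continuation_value :: "(nat \<Rightarrow> 's \<Rightarrow> real) \<Rightarrow> (nat \<Rightarrow> 's \<Rightarrow> real) \<Rightarrow> nat \<Rightarrow> bool" where
  "continuation_value g f i \<longleftrightarrow>
    memoryless_value i (\<lambda>\<omega>. indicator (best i) \<omega> *
      (\<Sum>k\<in>{i<..n}. indicator (best k) \<omega> * max 0 (g k (s k \<omega>) - f k (s k \<omega>)))) (f i) \<and>
    (\<forall>y. 0 \<le> f i y \<and> f i y \<le> real n)"

lemma continuation_valueD:
  assumes "continuation_value g f i"
  shows "f i \<in> borel_measurable S" "0 \<le> f i y" "f i y \<le> real n"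
  using assms by (auto simp: continuation_value_def dest: memoryless_value_measurable)

lemma hist_measurableD:
  assumes "i \<in> {1..n}" "X \<in> borel_measurable (hist i)"
  shows "X \<in> borel_measurable M"
  by (rule measurable_from_subalg[OF subalgebra_vimage[OF info_measurable[OF assms(1)]] assms(2)])

text \<open>Non-Filtering treats one later round at a time, so each \<open>k\<close> receives its
  own \<open>\<phi> k\<close>; by linearity their sum is a value for the whole future. The update at
  \<open>i\<close> leaves that sum over later rounds unchanged.\<close>

lemma continuation_value_step:
  assumes NF: "non_filtering n M r S s" and i: "i \<in> {1..n}"
    and g: "\<And>k. k \<in> {1..n} \<Longrightarrow> g k \<in> borel_measurable S"
    and g01: "\<And>k y. k \<in> {1..n} \<Longrightarrow> 0 \<le> g k y \<and> g k y \<le> 1"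
    and f: "\<And>k. k \<in> {i<..n} \<Longrightarrow> continuation_value g f k"
  shows "\<exists>h. continuation_value g (f(i := h)) i"
proof -
  let ?v = "\<lambda>k y. max 0 (g k y - f k y)"
  have fm: "f k \<in> borel_measurable S" "0 \<le> f k y" if "k \<in> {i<..n}" for k y
    using continuation_valueD[OF f[OF that]] by simp_all
  have vm: "?v k \<in> borel_measurable S" if "k \<in> {i<..n}" for k
    using g[of k] fm(1)[of k] i that by (intro borel_measurable_max borel_measurable_diff) auto
  \<comment> \<open>\<open>g k \<le> 1\<close> and \<open>f k \<ge> 0\<close> keep the gain in the
    range accepted by \<open>future_factor\<close>.\<close>
  have v01: "0 \<le> ?v k y \<and> ?v k y \<le> 1" if "k \<in> {i<..n}" for k y
    using g01[of k y] fm(2)[of k y] i that by auto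
  have "\<forall>k\<in>{i<..n}. \<exists>\<phi>. memoryless_value i
      (\<lambda>\<omega>. indicator (best i) \<omega> * (indicator (best k) \<omega> * ?v k (s k \<omega>))) \<phi> \<and>
      (\<forall>y. 0 \<le> \<phi> y \<and> \<phi> y \<le> 1)"
  proof
    fix k assume k: "k \<in> {i<..n}"
    show "\<exists>\<phi>. memoryless_value i
      (\<lambda>\<omega>. indicator (best i) \<omega> * (indicator (best k) \<omega> * ?v k (s k \<omega>))) \<phi> \<and>
      (\<forall>y. 0 \<le> \<phi> y \<and> \<phi> y \<le> 1)"
      by (rule future_factor[OF NF _ _ vm[OF k] v01[OF k]]) (use i k in auto)
  qed
  from bchoice[OF this] obtain \<phi> where \<phi>: "\<forall>k\<in>{i<..n}. memoryless_value i
      (\<lambda>\<omega>. indicator (best i) \<omega> * (indicator (best k) \<omega> * ?v k (s k \<omega>))) (\<phi> k) \<and>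
      (\<forall>y. 0 \<le> \<phi> k y \<and> \<phi> k y \<le> 1)" ..
  have \<phi>v: "memoryless_value i
      (\<lambda>\<omega>. indicator (best i) \<omega> * (indicator (best k) \<omega> * ?v k (s k \<omega>))) (\<phi> k)"
    and \<phi>01: "\<And>y. 0 \<le> \<phi> k y \<and> \<phi> k y \<le> 1" if "k \<in> {i<..n}" for k
    using bspec[OF \<phi> that] by simp_all
  note \<phi>m = memoryless_value_measurable[OF \<phi>v]
  define h where "h y = (\<Sum>k\<in>{i<..n}. \<phi> k y)" for y
  note [measurable] = best_event[OF i] signal_measurable[OF i]
  have "h y \<le> real n" for y
  proof -
    have "h y \<le> (\<Sum>k\<in>{i<..n}. 1)" unfolding h_def using \<phi>01 by (intro sum_mono) auto
    then show ?thesis by simp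
  qed
  moreover have "0 \<le> h y" for y unfolding h_def using \<phi>01 by (intro sum_nonneg) auto
  moreover have "h \<in> borel_measurable S" unfolding h_def using \<phi>m by (intro borel_measurable_sum)
  moreover have "(\<integral>\<omega>. X \<omega> * (indicator (best i) \<omega> *
          (\<Sum>k\<in>{i<..n}. indicator (best k) \<omega> * ?v k (s k \<omega>))) \<partial>M)
      = (\<integral>\<omega>. X \<omega> * (indicator (best i) \<omega> * h (s i \<omega>)) \<partial>M)" (is "?L = ?R")
    if X: "X \<in> borel_measurable (hist i)" "\<forall>\<omega>\<in>space M. 0 \<le> X \<omega> \<and> X \<omega> \<le> 1" for X
  proof -
    have XM[measurable]: "X \<in> borel_measurable M" by (rule hist_measurableD[OF i X(1)])
    have int: "integrable M (\<lambda>\<omega>. X \<omega> * (indicator (best i) \<omega> * F \<omega>))"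
      if "F \<in> borel_measurable M" "\<And>\<omega>. 0 \<le> F \<omega> \<and> F \<omega> \<le> 1" for F :: "'w \<Rightarrow> real"
    proof (rule integrable_bounded[where C = 1])
      show "(\<lambda>\<omega>. X \<omega> * (indicator (best i) \<omega> * F \<omega>)) \<in> borel_measurable M" using that(1) by measurable
      fix \<omega> assume "\<omega> \<in> space M"
      then show "\<bar>X \<omega> * (indicator (best i) \<omega> * F \<omega>)\<bar> \<le> 1"
        using X(2) that(2)[of \<omega>] by (auto simp: abs_mult indicator_def intro!: mult_le_one)
    qed
    have int1: "integrable M (\<lambda>\<omega>. X \<omega> * (indicator (best i) \<omega> * (indicator (best k) \<omega> * ?v k (s k \<omega>))))"
      if k: "k \<in> {i<..n}" for k
    proof (rule int)
      have k': "k \<in> {1..n}" using k i by auto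
      note [measurable] = best_event[OF k'] signal_measurable[OF k'] vm[OF k]
      have "(\<lambda>\<omega>. ?v k (s k \<omega>)) \<in> borel_measurable M"
        by (rule measurable_compose[OF signal_measurable[OF k'] vm[OF k]])
      then show "(\<lambda>\<omega>. indicator (best k) \<omega> * ?v k (s k \<omega>)) \<in> borel_measurable M"
        by (intro borel_measurable_times) auto
    qed (use v01[OF k] in \<open>auto simp: indicator_def\<close>)
    have int2: "integrable M (\<lambda>\<omega>. X \<omega> * (indicator (best i) \<omega> * \<phi> k (s i \<omega>)))"
      if k: "k \<in> {i<..n}" for k
      by (rule int) (use \<phi>01[OF k] measurable_compose[OF signal_measurable[OF i] \<phi>m[OF k]] in auto)
    have "?L = (\<integral>\<omega>. (\<Sum>k\<in>{i<..n}. X \<omega> * (indicator (best i) \<omega> * (indicator (best k) \<omega> * ?v k (s k \<omega>)))) \<partial>M)"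
      by (simp only: sum_distrib_left)
    also have "\<dots> = (\<Sum>k\<in>{i<..n}. \<integral>\<omega>. X \<omega> * (indicator (best i) \<omega> * (indicator (best k) \<omega> * ?v k (s k \<omega>))) \<partial>M)"
      by (rule Bochner_Integration.integral_sum) (rule int1)
    also have "\<dots> = (\<Sum>k\<in>{i<..n}. \<integral>\<omega>. X \<omega> * (indicator (best i) \<omega> * \<phi> k (s i \<omega>)) \<partial>M)"
      using X(2) by (intro sum.cong refl memoryless_value_integral[OF \<phi>v X(1)]) auto
    also have "\<dots> = (\<integral>\<omega>. (\<Sum>k\<in>{i<..n}. X \<omega> * (indicator (best i) \<omega> * \<phi> k (s i \<omega>))) \<partial>M)"
      by (rule Bochner_Integration.integral_sum[symmetric]) (rule int2)
    also have "\<dots> = ?R"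
      by (simp only: sum_distrib_left h_def)
    finally show ?thesis .
  qed
  ultimately show ?thesis
    unfolding continuation_value_def memoryless_value_def by (intro exI[of _ h]) simp
qed

lemma continuation_values_exist:
  assumes NF: "non_filtering n M r S s"
    and g: "\<And>k. k \<in> {1..n} \<Longrightarrow> g k \<in> borel_measurable S"
    and g01: "\<And>k y. k \<in> {1..n} \<Longrightarrow> 0 \<le> g k y \<and> g k y \<le> 1"
  shows "\<exists>f. \<forall>i\<in>{1..n}. continuation_value g f i"
proof -
  \<comment> \<open>The condition \<open>n < i + d\<close> selects the last \<open>d\<close> rounds;
    induction on \<open>d\<close> moves backward in time.\<close>
  have "\<exists>f. \<forall>i\<in>{1..n}. n < i + d \<longrightarrow> continuation_value g f i" for d
  proof (induction d)
    case (Suc d)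
    then obtain f where "\<forall>i\<in>{1..n}. n < i + d \<longrightarrow> continuation_value g f i" ..
    then have f: "continuation_value g f i" if "i \<in> {1..n}" "n < i + d" for i
      using that by blast
    show ?case
    proof (cases "d < n")
      case True
      \<comment> \<open>The latest round not yet covered.\<close>
      define i where "i = n - d"
      have i: "i \<in> {1..n}" using True by (auto simp: i_def)
      have "continuation_value g f k" if "k \<in> {i<..n}" for k
        by (rule f) (use that in \<open>auto simp: i_def\<close>)
      from continuation_value_step[OF NF i g g01 this]
      obtain h where h: "continuation_value g (f(i := h)) i" by auto
      have "continuation_value g (f(i := h)) k" if k: "k \<in> {1..n}" "n < k + Suc d" for k
      proof (cases "k = i")
        case False
        then have "i < k" using k True by (auto simp: i_def)
        \<comment> \<open>The relation at \<open>k\<close> reads \<open>f\<close> from round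
          \<open>k\<close> on, so a change at the earlier round \<open>i\<close> preserves
          it.\<close>
        then have "(f(i := h)) l = f l" if "l \<in> {k..n}" for l
          using that by auto
        then have "(\<Sum>l\<in>{k<..n}. indicat_real (best l) \<omega> * max 0 (g l (s l \<omega>) - (f(i := h)) l (s l \<omega>)))
            = (\<Sum>l\<in>{k<..n}. indicat_real (best l) \<omega> * max 0 (g l (s l \<omega>) - f l (s l \<omega>)))" for \<omega>
          by (intro sum.cong refl) (simp only: greaterThanAtMost_iff atLeastAtMost_iff less_imp_le)
        then have "continuation_value g (f(i := h)) k = continuation_value g f k"
          using False unfolding continuation_value_def by (simp only:) simp
        moreover have "continuation_value g f k" using \<open>i < k\<close> k by (intro f) (auto simp: i_def)
        ultimately show ?thesis by simp
      qed (use h in simp)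
      then show ?thesis by blast
    next
      case False
      then show ?thesis using f by (intro exI[of _ f]) auto
    qed
  qed auto
  from this[of n] show ?thesis by auto
qed

section \<open>The winning probability as an expected payoff\<close>

text \<open>On \<open>best i\<close>, \<open>f i\<close> and the sum of later gains have the same
  integral against every weight known from the history, in particular the stopping probability.
  Adding their difference, which contributes zero, yields an integrand that can be compared outcome
  by outcome.\<close>

lemma win_prob_eq:
  assumes \<pi>: "policy n S \<pi>"
    and gv: "\<And>i. i \<in> {1..n} \<Longrightarrow> memoryless_value i (indicator {\<omega> \<in> space M. r i \<omega> = n}) (g i)"
    and g01: "\<And>i y. i \<in> {1..n} \<Longrightarrow> 0 \<le> g i y \<and> g i y \<le> 1"
    and f: "\<And>i. i \<in> {1..n} \<Longrightarrow> continuation_value g f i"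
  shows "integrable M (\<lambda>\<omega>. \<Sum>i\<in>{1..n}. stop_prob r s \<pi> i \<omega> * (indicator (best i) \<omega> *
      (g i (s i \<omega>) - f i (s i \<omega>) +
        (\<Sum>k\<in>{i<..n}. indicator (best k) \<omega> * max 0 (g k (s k \<omega>) - f k (s k \<omega>))))))" (is ?int)
    and "win_prob n M r s \<pi> = (\<integral>\<omega>. (\<Sum>i\<in>{1..n}. stop_prob r s \<pi> i \<omega> * (indicator (best i) \<omega> *
      (g i (s i \<omega>) - f i (s i \<omega>) +
        (\<Sum>k\<in>{i<..n}. indicator (best k) \<omega> * max 0 (g k (s k \<omega>) - f k (s k \<omega>)))))) \<partial>M)" (is ?eq)
proof -
  let ?P = "stop_prob r s \<pi>"
  let ?W = "\<lambda>i. {\<omega> \<in> space M. r i \<omega> = n}"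
  let ?D = "\<lambda>i \<omega>. \<Sum>k\<in>{i<..n}. indicat_real (best k) \<omega> * max 0 (g k (s k \<omega>) - f k (s k \<omega>))"
  have fm: "f i \<in> borel_measurable S" and f0: "0 \<le> f i y" and fn: "f i y \<le> real n"
    if "i \<in> {1..n}" for i y
    using continuation_valueD[OF f[OF that]] by simp_all
  have gs: "(\<lambda>\<omega>. g i (s i \<omega>)) \<in> borel_measurable M" and fs: "(\<lambda>\<omega>. f i (s i \<omega>)) \<in> borel_measurable M"
    if "i \<in> {1..n}" for i
    using measurable_compose[OF signal_measurable[OF that] memoryless_value_measurable[OF gv[OF that]]]
      measurable_compose[OF signal_measurable[OF that] fm[OF that]] by auto
  have Ds: "?D i \<in> borel_measurable M" if "i \<in> {1..n}" for i
    using that by (intro borel_measurable_sum borel_measurable_times borel_measurable_max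
        borel_measurable_diff gs fs borel_measurable_indicator best_event) auto
  have Dn: "\<bar>?D i \<omega>\<bar> \<le> real n" if "i \<in> {1..n}" for i \<omega>
  proof -
    have "\<bar>?D i \<omega>\<bar> \<le> (\<Sum>k\<in>{i<..n}. \<bar>indicat_real (best k) \<omega> * max 0 (g k (s k \<omega>) - f k (s k \<omega>))\<bar>)"
      by (rule sum_abs)
    also have "\<dots> \<le> (\<Sum>k\<in>{i<..n}. 1)"
    proof (rule sum_mono)
      fix k assume "k \<in> {i<..n}"
      then have "k \<in> {1..n}" using that by auto
      then show "\<bar>indicat_real (best k) \<omega> * max 0 (g k (s k \<omega>) - f k (s k \<omega>))\<bar> \<le> 1"
        using g01[of k "s k \<omega>"] f0[of k "s k \<omega>"] by (auto simp: indicator_def)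
    qed
    finally show ?thesis by simp
  qed
  \<comment> \<open>Used for the win, continuation and future-gain terms, with bounds
    \<open>1\<close>, \<open>n\<close> and \<open>n\<close>.\<close>
  have int: "integrable M (\<lambda>\<omega>. ?P i \<omega> * (indicator (best i) \<omega> * F \<omega>))"
    if i: "i \<in> {1..n}" and F: "F \<in> borel_measurable M" "\<And>\<omega>. \<bar>F \<omega>\<bar> \<le> C"
    for F :: "'w \<Rightarrow> real" and C i
  proof (rule integrable_bounded[where C = C])
    note [measurable] = F(1) best_event[OF i] hist_measurableD[OF i stop_prob_hist_measurable[OF \<pi> i]]
    show "(\<lambda>\<omega>. ?P i \<omega> * (indicator (best i) \<omega> * F \<omega>)) \<in> borel_measurable M" by measurable
    fix \<omega> assume \<omega>: "\<omega> \<in> space M"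
    have "\<bar>indicator (best i) \<omega> * F \<omega>\<bar> \<le> C"
      using F(2)[of \<omega>] by (auto simp: indicator_def)
    then have "\<bar>?P i \<omega>\<bar> * \<bar>indicator (best i) \<omega> * F \<omega>\<bar> \<le> 1 * C"
      using stop_prob_bounds[OF \<pi> i \<omega>] by (intro mult_mono) auto
    then show "\<bar>?P i \<omega> * (indicator (best i) \<omega> * F \<omega>)\<bar> \<le> C" by (simp add: abs_mult)
  qed
  have ig: "integrable M (\<lambda>\<omega>. ?P i \<omega> * (indicator (best i) \<omega> * g i (s i \<omega>)))"
    and jf: "integrable M (\<lambda>\<omega>. ?P i \<omega> * (indicator (best i) \<omega> * f i (s i \<omega>)))"
    and iD: "integrable M (\<lambda>\<omega>. ?P i \<omega> * (indicator (best i) \<omega> * ?D i \<omega>))" if i: "i \<in> {1..n}" for i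
    using int[OF i gs[OF i], of 1] int[OF i fs[OF i], of n] int[OF i Ds[OF i] Dn[OF i]]
      g01[OF i] f0[OF i] fn[OF i] by (simp_all add: abs_of_nonneg)
  have split: "?P i \<omega> * (indicator (best i) \<omega> * (g i (s i \<omega>) - f i (s i \<omega>) + ?D i \<omega>))
     = ?P i \<omega> * (indicator (best i) \<omega> * g i (s i \<omega>)) - ?P i \<omega> * (indicator (best i) \<omega> * f i (s i \<omega>))
      + ?P i \<omega> * (indicator (best i) \<omega> * ?D i \<omega>)" for i \<omega>
    by (simp only: distrib_left right_diff_distrib)
  have int3: "integrable M (\<lambda>\<omega>. ?P i \<omega> * (indicator (best i) \<omega> * (g i (s i \<omega>) - f i (s i \<omega>) + ?D i \<omega>)))"
    if "i \<in> {1..n}" for i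
    unfolding split using ig[OF that] jf[OF that] iD[OF that] by simp
  then show ?int by (intro Bochner_Integration.integrable_sum)
  have stop01: "\<forall>\<omega>\<in>space M. 0 \<le> ?P i \<omega> \<and> ?P i \<omega> \<le> 1" if "i \<in> {1..n}" for i
    using stop_prob_bounds[OF \<pi> that] by auto
  have eq: "(\<integral>\<omega>. ?P i \<omega> * indicator (?W i) \<omega> \<partial>M)
    = (\<integral>\<omega>. ?P i \<omega> * (indicator (best i) \<omega> * (g i (s i \<omega>) - f i (s i \<omega>) + ?D i \<omega>)) \<partial>M)"
    if i: "i \<in> {1..n}" for i
  proof -
    have fv: "memoryless_value i (\<lambda>\<omega>. indicator (best i) \<omega> * ?D i \<omega>) (f i)"
      using f[OF i] by (simp add: continuation_value_def)
    note h = stop_prob_hist_measurable[OF \<pi> i] bspec[OF stop01[OF i]]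
    have "(\<integral>\<omega>. ?P i \<omega> * (indicator (best i) \<omega> * ?D i \<omega>) \<partial>M)
      = (\<integral>\<omega>. ?P i \<omega> * (indicator (best i) \<omega> * f i (s i \<omega>)) \<partial>M)"
      by (rule memoryless_value_integral[OF fv h])
    then show ?thesis
      unfolding split using ig[OF i] jf[OF i] iD[OF i] memoryless_value_integral[OF gv[OF i] h] by simp
  qed
  have intW: "integrable M (\<lambda>\<omega>. ?P i \<omega> * indicator (?W i) \<omega>)" if i: "i \<in> {1..n}" for i
  proof (rule integrable_bounded[where C = 1])
    note [measurable] = rank_measurable[OF i] hist_measurableD[OF i stop_prob_hist_measurable[OF \<pi> i]]
    show "(\<lambda>\<omega>. ?P i \<omega> * indicator (?W i) \<omega>) \<in> borel_measurable M" by measurable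
  qed (use stop01[OF i] in \<open>auto simp: indicator_def\<close>)
  have "win_prob n M r s \<pi> = (\<integral>\<omega>. (\<Sum>i\<in>{1..n}. ?P i \<omega> * indicator (?W i) \<omega>) \<partial>M)"
    unfolding win_prob_def
    by (intro Bochner_Integration.integral_cong sum.cong) (auto simp: indicator_def)
  also have "\<dots> = (\<Sum>i\<in>{1..n}. \<integral>\<omega>. ?P i \<omega> * indicator (?W i) \<omega> \<partial>M)"
    by (rule Bochner_Integration.integral_sum) (rule intW)
  also have "\<dots> = (\<Sum>i\<in>{1..n}. \<integral>\<omega>. ?P i \<omega> * (indicator (best i) \<omega> * (g i (s i \<omega>) - f i (s i \<omega>) + ?D i \<omega>)) \<partial>M)"
    by (intro sum.cong refl eq)
  also have "\<dots> = (\<integral>\<omega>. (\<Sum>i\<in>{1..n}. ?P i \<omega> * (indicator (best i) \<omega> * (g i (s i \<omega>) - f i (s i \<omega>) + ?D i \<omega>))) \<partial>M)"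
    by (rule Bochner_Integration.integral_sum[symmetric]) (rule int3)
  finally show ?eq .
qed

section \<open>Comparison of payoffs for a fixed outcome\<close>

text \<open>Passing from \<open>d i\<close> to its positive part and dropping the best-so-far
  indicator can only raise the payoff. Then each gain is weighted by the probability of having
  stopped by its round, which is at most 1.\<close>

lemma stopping_payoff_le:
  assumes \<pi>: "policy n S \<pi>" and \<omega>: "\<omega> \<in> space M"
  shows "(\<Sum>i\<in>{1..n}. stop_prob r s \<pi> i \<omega> * (indicator (best i) \<omega> *
      (d i + (\<Sum>k\<in>{i<..n}. indicator (best k) \<omega> * max 0 (d k)))))
    \<le> (\<Sum>k\<in>{1..n}. indicator (best k) \<omega> * max 0 (d k :: real))"
proof -
  let ?c = "\<lambda>k. indicator (best k) \<omega> * max 0 (d k)"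
  let ?p = "\<lambda>j. \<pi> j (info r s j \<omega>)"
  have "(\<Sum>i\<in>{1..n}. stop_prob r s \<pi> i \<omega> * (indicator (best i) \<omega> * (d i + (\<Sum>k\<in>{i<..n}. ?c k))))
    \<le> (\<Sum>i\<in>{1..n}. stop_prob r s \<pi> i \<omega> * (\<Sum>k\<in>{i..n}. ?c k))"
  proof (intro sum_mono mult_left_mono)
    fix i assume i: "i \<in> {1..n}"
    have "{i..n} = insert i {i<..n}" using i by auto
    then have "(\<Sum>k\<in>{i..n}. ?c k) = ?c i + (\<Sum>k\<in>{i<..n}. ?c k)"
      by (simp only:) (rule sum.insert, auto)
    \<comment> \<open>Decisive when \<open>i\<close> is not best so far: the left side is then
      zero.\<close>
    moreover have "0 \<le> (\<Sum>k\<in>{i<..n}. ?c k)" by (intro sum_nonneg) auto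
    ultimately show "indicator (best i) \<omega> * (d i + (\<Sum>k\<in>{i<..n}. ?c k)) \<le> (\<Sum>k\<in>{i..n}. ?c k)"
      by (cases "\<omega> \<in> best i") auto
  qed (use stop_prob_bounds[OF \<pi> _ \<omega>] in auto)
  also have "\<dots> = (\<Sum>k\<in>{1..n}. ?c k * (1 - (\<Prod>j\<in>{1..k}. 1 - ?p j)))"
    unfolding stop_prob_def by (rule sum_stopping_tail_eq)
  also have "\<dots> \<le> (\<Sum>k\<in>{1..n}. ?c k * 1)"
  proof (intro sum_mono mult_left_mono)
    fix k assume "k \<in> {1..n}"
    then have "0 \<le> (\<Prod>j\<in>{1..k}. 1 - ?p j)"
      using policy_bounds[OF \<pi> _ \<omega>] by (intro prod_nonneg) auto
    then show "1 - (\<Prod>j\<in>{1..k}. 1 - ?p j) \<le> 1" by simp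
  qed auto
  finally show ?thesis by simp
qed

text \<open>Both estimates of \<open>stopping_payoff_le\<close> are tight: stopping occurs only
  where \<open>d i\<close> equals its positive part on \<open>best i\<close>, and a nonzero gain at
  \<open>k\<close> forces stopping by round \<open>k\<close>, which makes its weight 1.\<close>

lemma stopping_payoff_eq:
  assumes \<pi>: "\<And>i. i \<in> {1..n} \<Longrightarrow> \<pi> i (info r s i \<omega>) = (if \<omega> \<in> best i \<and> 0 < d i then 1 else 0)"
  shows "(\<Sum>i\<in>{1..n}. stop_prob r s \<pi> i \<omega> * (indicator (best i) \<omega> *
      (d i + (\<Sum>k\<in>{i<..n}. indicator (best k) \<omega> * max 0 (d k)))))
    = (\<Sum>k\<in>{1..n}. indicator (best k) \<omega> * max 0 (d k :: real))"
proof -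
  let ?c = "\<lambda>k. indicator (best k) \<omega> * max 0 (d k)"
  let ?p = "\<lambda>j. \<pi> j (info r s j \<omega>)"
  have "(\<Sum>i\<in>{1..n}. stop_prob r s \<pi> i \<omega> * (indicator (best i) \<omega> * (d i + (\<Sum>k\<in>{i<..n}. ?c k))))
    = (\<Sum>i\<in>{1..n}. stop_prob r s \<pi> i \<omega> * (\<Sum>k\<in>{i..n}. ?c k))"
  proof (intro sum.cong refl)
    fix i assume i: "i \<in> {1..n}"
    have "{i..n} = insert i {i<..n}" using i by auto
    then have "(\<Sum>k\<in>{i..n}. ?c k) = ?c i + (\<Sum>k\<in>{i<..n}. ?c k)"
      by (simp only:) (rule sum.insert, auto)
    then show "stop_prob r s \<pi> i \<omega> * (indicator (best i) \<omega> * (d i + (\<Sum>k\<in>{i<..n}. ?c k)))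
        = stop_prob r s \<pi> i \<omega> * (\<Sum>k\<in>{i..n}. ?c k)"
      using \<pi>[OF i] by (cases "\<omega> \<in> best i \<and> 0 < d i") (auto simp: stop_prob_def)
  qed
  also have "\<dots> = (\<Sum>k\<in>{1..n}. ?c k * (1 - (\<Prod>j\<in>{1..k}. 1 - ?p j)))"
    unfolding stop_prob_def by (rule sum_stopping_tail_eq)
  also have "\<dots> = (\<Sum>k\<in>{1..n}. ?c k)"
  proof (intro sum.cong refl)
    fix k assume k: "k \<in> {1..n}"
    show "?c k * (1 - (\<Prod>j\<in>{1..k}. 1 - ?p j)) = ?c k"
    proof (cases "\<omega> \<in> best k \<and> 0 < d k")
      case True
      then have "(\<Prod>j\<in>{1..k}. 1 - ?p j) = 0"
        using k \<pi>[OF k] by (intro prod_zero) (auto intro!: bexI[of _ k])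
      then show ?thesis by simp
    qed auto
  qed
  finally show ?thesis .
qed

section \<open>The threshold policy and its optimality\<close>

lemma threshold_policy:
  fixes d :: "nat \<Rightarrow> 's \<Rightarrow> real"
  assumes d: "\<And>i. i \<in> {1..n} \<Longrightarrow> d i \<in> borel_measurable S"
  defines "\<pi> \<equiv> \<lambda>i x. if (\<forall>j\<in>{1..<i}. (j, i) \<in> fst x) \<and> 0 < d i (snd x i) then 1 else (0::real)"
  shows "policy n S \<pi>" "memoryless n S \<pi>"
    and "\<And>i \<omega>. i \<in> {1..n} \<Longrightarrow> \<omega> \<in> space M \<Longrightarrow>
      \<pi> i (info r s i \<omega>) = (if \<omega> \<in> best i \<and> 0 < d i (s i \<omega>) then 1 else 0)"
proof -
  have "\<pi> i \<in> borel_measurable (info_space S i)" if i: "i \<in> {1..n}" for i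
  proof -
    \<comment> \<open>Relative orders carry the discrete algebra, so every predicate of them is
      measurable.\<close>
    have "(\<lambda>R. \<forall>j\<in>{1..<i}. (j, i) \<in> R)
        \<in> measurable (count_space (Pow ({1..i} \<times> {1..i}))) (count_space UNIV)" by simp
    from measurable_compose[OF measurable_fst this]
    have bsf: "Measurable.pred (info_space S i) (\<lambda>x. \<forall>j\<in>{1..<i}. (j, i) \<in> fst x)"
      unfolding info_space_def .
    have "(\<lambda>\<sigma>. \<sigma> i) \<in> measurable (\<Pi>\<^sub>M j\<in>{1..i}. S) S"
      using i by (intro measurable_component_singleton) auto
    from measurable_compose[OF measurable_compose[OF measurable_snd this] d[OF i]]
    have dm: "(\<lambda>x. d i (snd x i)) \<in> borel_measurable (info_space S i)"
      unfolding info_space_def .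
    have "{x \<in> space (info_space S i). 0 < d i (snd x i)} \<in> sets (info_space S i)"
      using dm by (auto simp: borel_measurable_iff_greater)
    from sets.sets_Collect_conj[OF this predE[OF bsf]] show ?thesis
      unfolding \<pi>_def by (intro measurable_If) auto
  qed
  then show "policy n S \<pi>" by (auto simp: policy_def \<pi>_def)
  show "memoryless n S \<pi>"
    unfolding memoryless_def
    by (rule exI[of _ "\<lambda>i b y. if b \<and> 0 < d i y then 1 else 0"]) (auto simp: \<pi>_def)
  fix i \<omega> assume "i \<in> {1..n}" "\<omega> \<in> space M"
  then show "\<pi> i (info r s i \<omega>) = (if \<omega> \<in> best i \<and> 0 < d i (s i \<omega>) then 1 else 0)"
    by (auto simp: \<pi>_def info_def rel_order_def best_so_far_def)
qed

lemma optimal_memoryless_policy: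
  assumes NF: "non_filtering n M r S s" and HI: "history_irrelevance n M r S s"
  shows "\<exists>\<pi>. policy n S \<pi> \<and> memoryless n S \<pi> \<and>
           (\<forall>\<pi>'. policy n S \<pi>' \<longrightarrow> win_prob n M r s \<pi>' \<le> win_prob n M r s \<pi>)"
proof -
  have "\<forall>i\<in>{1..n}. \<exists>g. memoryless_value i (indicator {\<omega> \<in> space M. r i \<omega> = n}) g \<and>
      (\<forall>y. 0 \<le> g y \<and> g y \<le> 1)"
    using win_factor[OF HI] by blast
  from bchoice[OF this] obtain g where g: "\<forall>i\<in>{1..n}.
      memoryless_value i (indicator {\<omega> \<in> space M. r i \<omega> = n}) (g i) \<and>
      (\<forall>y. 0 \<le> g i y \<and> g i y \<le> 1)" ..
  have gv: "memoryless_value i (indicator {\<omega> \<in> space M. r i \<omega> = n}) (g i)"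
    and g01: "\<And>y. 0 \<le> g i y \<and> g i y \<le> 1" if "i \<in> {1..n}" for i
    using bspec[OF g that] by simp_all
  note gm = memoryless_value_measurable[OF gv]
  obtain f where "\<forall>i\<in>{1..n}. continuation_value g f i"
    using continuation_values_exist[of g, OF NF gm g01] by blast
  then have f: "continuation_value g f i" if "i \<in> {1..n}" for i
    using that by blast
  have "(\<lambda>y. g i y - f i y) \<in> borel_measurable S" if "i \<in> {1..n}" for i
    using gm[OF that] continuation_valueD(1)[OF f[OF that]] by simp
  from threshold_policy[of "\<lambda>i y. g i y - f i y", OF this]
  obtain \<pi> where \<pi>: "policy n S \<pi>" "memoryless n S \<pi>"
    and \<pi>_eq: "\<And>i \<omega>. i \<in> {1..n} \<Longrightarrow> \<omega> \<in> space M \<Longrightarrow>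
      \<pi> i (info r s i \<omega>) = (if \<omega> \<in> best i \<and> 0 < g i (s i \<omega>) - f i (s i \<omega>) then 1 else 0)"
    by blast
  let ?payoff = "\<lambda>\<pi> \<omega>. \<Sum>i\<in>{1..n}. stop_prob r s \<pi> i \<omega> * (indicat_real (best i) \<omega> *
      (g i (s i \<omega>) - f i (s i \<omega>) +
        (\<Sum>k\<in>{i<..n}. indicat_real (best k) \<omega> * max 0 (g k (s k \<omega>) - f k (s k \<omega>)))))"
  have int: "integrable M (?payoff \<pi>)" if "policy n S \<pi>" for \<pi>
    by (rule win_prob_eq(1)[OF that gv g01 f])
  have eq: "win_prob n M r s \<pi> = (\<integral>\<omega>. ?payoff \<pi> \<omega> \<partial>M)" if "policy n S \<pi>" for \<pi>
    by (rule win_prob_eq(2)[OF that gv g01 f])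
  have "win_prob n M r s \<pi>' \<le> win_prob n M r s \<pi>" if \<pi>': "policy n S \<pi>'" for \<pi>'
  proof -
    \<comment> \<open>Both sides are compared with the same sum of gains, which mentions no policy:
      it bounds the left side and equals the right side.\<close>
    have "?payoff \<pi>' \<omega> \<le> ?payoff \<pi> \<omega>" if \<omega>: "\<omega> \<in> space M" for \<omega>
      using stopping_payoff_le[OF \<pi>' \<omega>, of "\<lambda>i. g i (s i \<omega>) - f i (s i \<omega>)"]
        stopping_payoff_eq[of \<pi> \<omega> "\<lambda>i. g i (s i \<omega>) - f i (s i \<omega>)", OF \<pi>_eq[OF _ \<omega>]] by simp
    then show ?thesis
      unfolding eq[OF \<pi>'] eq[OF \<pi>(1)] by (rule integral_mono[OF int[OF \<pi>'] int[OF \<pi>(1)]])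
  qed
  with \<pi> show ?thesis by blast
qed

end

theorem theorem1:
  fixes n :: nat and M :: "'w measure" and r :: "nat \<Rightarrow> 'w \<Rightarrow> nat"
    and S :: "'s measure" and s :: "nat \<Rightarrow> 'w \<Rightarrow> 's"
  assumes "secretary_advice n M r S s"
    and "non_filtering n M r S s"
    and "history_irrelevance n M r S s"
  shows "\<exists>\<pi>. policy n S \<pi> \<and> memoryless n S \<pi> \<and>
           (\<forall>\<pi>'. policy n S \<pi>' \<longrightarrow> win_prob n M r s \<pi>' \<le> win_prob n M r s \<pi>)"
  using secretary_advice.optimal_memoryless_policy[OF assms] .

end
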